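(* For fixed $E\in\mathbb R$, "critical point of $f$" refers to a critical point of $q\mapsto f(E,q)$ in the interval $[0,1)$. 1) If $E<E_\infty$ then $f$ is decreasing in $q$ and has no critical points. 2) If $E>E_\infty$ the following holds: (a) If $\beta/\tilde\beta_c<r_-(E/E_\infty)$ then $f$ has no critical points. (b) If $\beta/\tilde\beta_c=r_-(E/E_\infty)$ then $f$ has exactly one critical point, namely a saddle point at $q=\frac{p-2}p$. (c) If $r_-(E/E_\infty)<\beta/\tilde\beta_c<r_+(E/E_\infty)$ then $f$ has exactly two critical points: a local maximum in $D_\beta\cap(\frac{p-2}p,1)$ and a local minimum in $(0,\frac{p-2}p)$. (d) If $\beta/\tilde\beta_c=r_+(E/E_\infty)$ then $f$ has exactly three critical points: a local maximum in $D_\beta\cap(\frac{p-2}p,1)$, a local minimum in $(0,\frac{p-2}p)$ and a saddle point at $q=\frac{p-2}p$. (e) If $\beta/\tilde\beta_c>r_+(E/E_\infty)$ then $f$ has exactly four critical points: in $(0,\frac{p-2}p)$ a local maximum outside $D_\beta$ and a local minimum, and in $(\frac{p-2}p,1)$ a local maximum inside $D_\beta$ and a local minimum outside $D_\beta$. 3) If $E=E_\infty$ (so that $r_+(E/E_\infty)=r_-(E/E_\infty)=1$) then $f$ is decreasing in $q$ and has (a) no critical points if $\beta/\tilde\beta_c<1$; (b) a single critical point, at $q=\frac{p-2}p$, which is a saddle point, if $\beta/\tilde\beta_c=1$; (c) exactly two critical points, one saddle point in $(\frac{p-2}p,1)$ and one saddle point in $(0,\frac{p-2}p)$, if $\bet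a/\tilde\beta_c>1$.
   Context: Fix an integer $p\ge3$ and $\beta\ge0$. $f(E,q)=\beta q^{p/2}E+\frac12\log(1-q)+\frac{\beta^2}2\big(1-p(1-q)q^{p-1}-q^p\big)$ for $E\in\mathbb R$, $q\in[0,1)$. $E_\infty=2\sqrt{(p-1)/p}$, $\tilde\beta_c=\frac12\sqrt{\frac{p^{p-1}}{(p-1)(p-2)^{p-2}}}$, $r_\pm(x)=x\pm\sqrt{x^2-1}$ for $x\ge1$. $D_\beta=\{q\in[0,1]:A(q,\beta)\le 0\}$, where $A(q,\beta)=\sup_{r\in(0,1)}\Big(\beta^2(1-q)\frac{p(q+r(1-q))^{p-1}-pq^{p-1}}{r}-\frac1{1-r}\Big)$. A "saddle point" is a critical point that is neither a local maximum nor a local minimum. *)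

theory Defs
  imports "HOL-Analysis.Analysis"
begin

(* Differentiability and extremality are relative to the set S, so that at a boundary point of S
   (here: 0 in {0..<1}) they are one-sided.  Extrema are non-strict. *)

definition critical_point_on :: "real set \<Rightarrow> (real \<Rightarrow> real) \<Rightarrow> real \<Rightarrow> bool" where
  "critical_point_on S g x \<longleftrightarrow> x \<in> S \<and> (g has_real_derivative 0) (at x within S)"

definition local_maximum_on :: "real set \<Rightarrow> (real \<Rightarrow> real) \<Rightarrow> real \<Rightarrow> bool" where
  "local_maximum_on S g x \<longleftrightarrow> x \<in> S \<and> (\<forall>\<^sub>F y in at x within S. g y \<le> g x)"

definition local_minimum_on :: "real set \<Rightarrow> (real \<Rightarrow> real) \<Rightarrow> real \<Rightarrow> bool" where
  "local_minimum_on S g x \<longleftrightarrow> x \<in> S \<and> (\<forall>\<^sub>F y in at x within S. g x \<le> g y)"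

definition saddle_point_on :: "real set \<Rightarrow> (real \<Rightarrow> real) \<Rightarrow> real \<Rightarrow> bool" where
  "saddle_point_on S g x \<longleftrightarrow>
     critical_point_on S g x \<and> \<not> local_maximum_on S g x \<and> \<not> local_minimum_on S g x"

definition critical_points :: "(real \<Rightarrow> real) \<Rightarrow> real set" where
  "critical_points g = {q. critical_point_on {0..<1} g q}"

abbreviation local_maximum :: "(real \<Rightarrow> real) \<Rightarrow> real \<Rightarrow> bool" where
  "local_maximum \<equiv> local_maximum_on {0..<1}"

abbreviation local_minimum :: "(real \<Rightarrow> real) \<Rightarrow> real \<Rightarrow> bool" where
  "local_minimum \<equiv> local_minimum_on {0..<1}"

abbreviation saddle_point :: "(real \<Rightarrow> real) \<Rightarrow> real \<Rightarrow> bool" where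
  "saddle_point \<equiv> saddle_point_on {0..<1}"

definition free_energy :: "nat \<Rightarrow> real \<Rightarrow> real \<Rightarrow> real \<Rightarrow> real" where
  "free_energy p \<beta> E q =
     \<beta> * q powr (real p / 2) * E + 1 / 2 * ln (1 - q)
     + \<beta>\<^sup>2 / 2 * (1 - real p * (1 - q) * q ^ (p - 1) - q ^ p)"

definition E_infty :: "nat \<Rightarrow> real" where
  "E_infty p = 2 * sqrt ((real p - 1) / real p)"

definition beta_c :: "nat \<Rightarrow> real" where
  "beta_c p = 1 / 2 * sqrt (real p ^ (p - 1) / ((real p - 1) * (real p - 2) ^ (p - 2)))"

definition r_plus :: "real \<Rightarrow> real" where
  "r_plus x = x + sqrt (x\<^sup>2 - 1)"

definition r_minus :: "real \<Rightarrow> real" where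
  "r_minus x = x - sqrt (x\<^sup>2 - 1)"

(* For q in [0,1] the supremum is over a nonempty set bounded above by
   beta^2 (1-q)^2 p (p-1) (mean value theorem), so the real-valued SUP is the genuine one. *)
definition A_sup :: "nat \<Rightarrow> real \<Rightarrow> real \<Rightarrow> real" where
  "A_sup p q \<beta> =
     (SUP r\<in>{0<..<1}.
        \<beta>\<^sup>2 * (1 - q) * ((real p * (q + r * (1 - q)) ^ (p - 1) - real p * q ^ (p - 1)) / r)
        - 1 / (1 - r))"

definition D_set :: "nat \<Rightarrow> real \<Rightarrow> real set" where
  "D_set p \<beta> = {q \<in> {0..1}. A_sup p q \<beta> \<le> 0}"

end

theory Submission
  imports Defs
begin

text \<open>
  Put \<open>u q = \<beta> * sqrt (p (p - 1)) * q powr (p / 2 - 1) * (1 - q)\<close> and \<open>x = E / E_infty p\<close>. Then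
  \<open>2 (1 - q) f' q = 2 x u - 1 - u\<^sup>2\<close>, so the sign of the derivative of \<open>f\<close> at \<open>q\<close> depends only on
  the position of \<open>u q\<close> relative to the roots \<open>r_minus x\<close> and \<open>r_plus x\<close>. As \<open>u\<close> increases from \<open>0\<close>
  to its maximum \<open>\<beta> / beta_c p\<close> at \<open>q = (p - 2) / p\<close> and then decreases to \<open>0\<close>, the critical points
  can be read off from the level sets of \<open>u\<close>. On \<open>[(p - 2) / p, 1)\<close> membership in \<open>D_set p \<beta>\<close>
  follows from \<open>u q \<le> 1\<close>, and \<open>u q > 1\<close> excludes it everywhere.
\<close>

section \<open>Monotonicity, local extrema and saddle points from the sign of a derivative\<close>

text \<open>The sign of the derivative gives weak monotonicity. If it failed to be strict between
  \<open>x\<close> and \<open>y\<close>, then \<open>g\<close> would be constant on that interval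
  and \<open>g'\<close> would vanish at infinitely many points. This allows \<open>g\<close> to have
  inflection points, which are the saddle points met later.\<close>

lemma strict_mono_on_deriv_nonneg_finite_zeros:
  fixes g g' :: "real \<Rightarrow> real"
  assumes S: "is_interval S"
    and deriv: "\<And>q. q \<in> S \<Longrightarrow> (g has_real_derivative g' q) (at q within S)"
    and nonneg: "\<And>q. q \<in> S \<Longrightarrow> 0 \<le> g' q"
    and fin: "finite {q \<in> S. g' q = 0}"
  shows "strict_mono_on S g"
proof (rule strict_mono_onI)
  fix x y assume xy: "x \<in> S" "y \<in> S" "x < y"
  have sub: "{x..y} \<subseteq> S"
    using mem_is_interval_1_I[OF S xy(1,2)] by auto
  have at: "(g has_real_derivative g' z) (at z)" if "x < z" "z < y" for z
  proof -
    have "z \<in> {x<..<y}" "{x<..<y} \<subseteq> S" using that sub by auto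
    then show ?thesis
      using has_field_derivative_subset[OF deriv, of z "{x<..<y}"] at_within_open[of z "{x<..<y}"]
      by auto
  qed
  have cont: "continuous_on S g"
    using deriv by (meson DERIV_continuous_on)
  have mono: "g a \<le> g b" if "x \<le> a" "a \<le> b" "b \<le> y" for a b
  proof (rule DERIV_nonneg_imp_increasing_open[OF that(2)])
    show "\<exists>d. (g has_real_derivative d) (at z) \<and> 0 \<le> d" if "a < z" "z < b" for z
    proof (intro exI conjI)
      have z: "x < z" "z < y" using that \<open>x \<le> a\<close> \<open>b \<le> y\<close> by auto
      then show "(g has_real_derivative g' z) (at z)" by (rule at)
      show "0 \<le> g' z" using z sub by (intro nonneg) auto
    qed
    show "continuous_on {a..b} g"
      using cont by (rule continuous_on_subset) (use sub that in auto)
  qed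
  show "g x < g y"
  proof (rule ccontr)
    assume "\<not> g x < g y"
    then have const: "g z = g x" if "x \<le> z" "z \<le> y" for z
      using mono[of x z] mono[of z y] that by linarith
    have "g' z = 0" if "x < z" "z < y" for z
    proof -
      have "((\<lambda>_. g x) has_real_derivative g' z) (at z)"
        by (rule has_field_derivative_transform_within_open[OF at[OF that], of "{x<..<y}"])
          (use that in \<open>auto intro: const\<close>)
      then show ?thesis
        by (rule DERIV_unique[OF _ DERIV_const])
    qed
    then have "{x<..<y} \<subseteq> {q \<in> S. g' q = 0}"
      using sub by auto
    then show False
      using fin infinite_Ioo[OF \<open>x < y\<close>] finite_subset by blast
  qed
qed

lemma strict_antimono_on_deriv_nonpos_finite_zeros:
  fixes g g' :: "real \<Rightarrow> real"
  assumes "is_interval S"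
    and "\<And>q. q \<in> S \<Longrightarrow> (g has_real_derivative g' q) (at q within S)"
    and "\<And>q. q \<in> S \<Longrightarrow> g' q \<le> 0"
    and "finite {q \<in> S. g' q = 0}"
  shows "strict_antimono_on S g"
proof -
  have "strict_mono_on S (\<lambda>q. - g q)"
    by (rule strict_mono_on_deriv_nonneg_finite_zeros[where g' = "\<lambda>q. - g' q"])
      (use assms in \<open>auto intro: DERIV_minus\<close>)
  then show ?thesis
    by (auto simp: monotone_on_def)
qed

text \<open>By the mean value theorem \<open>g\<close> rises up to \<open>x\<close> and falls after
  it. The signs are weak, and none is asked for at \<open>x\<close> itself. Since the open interval
  lies in \<open>S\<close>, derivatives relative to \<open>S\<close> are two-sided there.\<close>

lemma local_maximum_onI:
  fixes g g' :: "real \<Rightarrow> real"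
  assumes x: "a < x" "x < b" and sub: "{a<..<b} \<subseteq> S"
    and deriv: "\<And>q. q \<in> S \<Longrightarrow> (g has_real_derivative g' q) (at q within S)"
    and left: "\<And>q. a < q \<Longrightarrow> q < x \<Longrightarrow> 0 \<le> g' q"
    and right: "\<And>q. x < q \<Longrightarrow> q < b \<Longrightarrow> g' q \<le> 0"
  shows "local_maximum_on S g x"
proof -
  have at: "(g has_real_derivative g' z) (at z)" if "z \<in> {a<..<b}" for z
    using has_field_derivative_subset[OF deriv, of z "{a<..<b}"] at_within_open[of z "{a<..<b}"]
      that sub by auto
  then have cont: "continuous_on {a<..<b} g"
    by (intro continuous_at_imp_continuous_on ballI DERIV_isCont)
  have le: "g y \<le> g x" if y: "y \<in> {a<..<b}" for y
  proof (cases "y \<le> x")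
    case True
    show ?thesis
    proof (rule DERIV_nonneg_imp_increasing_open[OF True])
      show "\<exists>d. (g has_real_derivative d) (at z) \<and> 0 \<le> d" if "y < z" "z < x" for z
        using at[of z] left[of z] that x y by fastforce
      show "continuous_on {y..x} g"
        using cont by (rule continuous_on_subset) (use x y in auto)
    qed
  next
    case False
    then have "x \<le> y" by simp
    then show ?thesis
    proof (rule DERIV_nonpos_imp_decreasing_open)
      show "\<exists>d. (g has_real_derivative d) (at z) \<and> d \<le> 0" if "x < z" "z < y" for z
        using at[of z] right[of z] that x y by fastforce
      show "continuous_on {x..y} g"
        using cont by (rule continuous_on_subset) (use x y in auto)
    qed
  qed
  have "\<forall>\<^sub>F y in at x within S. y \<in> {a<..<b}"
    using x eventually_at_in_open'[of "{a<..<b}" x] filter_leD[OF at_le[of S UNIV x]] by auto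
  then show ?thesis
    using x sub by (auto simp: local_maximum_on_def elim: eventually_mono intro!: le)
qed

lemma local_minimum_on_iff_maximum_uminus:
  "local_minimum_on S g x \<longleftrightarrow> local_maximum_on S (\<lambda>q. - g q) x"
  by (simp add: local_minimum_on_def local_maximum_on_def)

lemma local_maximum_on_iff_minimum_uminus:
  "local_maximum_on S g x \<longleftrightarrow> local_minimum_on S (\<lambda>q. - g q) x"
  by (simp add: local_minimum_on_def local_maximum_on_def)

lemma local_minimum_onI:
  fixes g g' :: "real \<Rightarrow> real"
  assumes "a < x" "x < b" and "{a<..<b} \<subseteq> S"
    and "\<And>q. q \<in> S \<Longrightarrow> (g has_real_derivative g' q) (at q within S)"
    and "\<And>q. a < q \<Longrightarrow> q < x \<Longrightarrow> g' q \<le> 0"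
    and "\<And>q. x < q \<Longrightarrow> q < b \<Longrightarrow> 0 \<le> g' q"
  shows "local_minimum_on S g x"
  unfolding local_minimum_on_iff_maximum_uminus
  by (rule local_maximum_onI[of a x b S _ "\<lambda>q. - g' q"]) (use assms in \<open>auto intro: DERIV_minus\<close>)

text \<open>Points immediately to the right of \<open>x\<close> have larger values, and the filter
  \<open>at_right x\<close> is nontrivial.\<close>

lemma strict_mono_on_not_local_maximum_on:
  fixes g :: "real \<Rightarrow> real"
  assumes x: "x \<in> {a<..<b}" and sub: "{a<..<b} \<subseteq> S" and mono: "strict_mono_on {a<..<b} g"
  shows "\<not> local_maximum_on S g x"
proof
  assume "local_maximum_on S g x"
  then have ev: "\<forall>\<^sub>F y in at x within S. g y \<le> g x"
    by (simp add: local_maximum_on_def)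
  have "x \<in> interior S"
    using x sub by (meson interior_maximal open_greaterThanLessThan subsetD)
  then have "\<forall>\<^sub>F y in at_right x. g y \<le> g x"
    using ev by (metis at_within_interior at_le filter_leD top_greatest)
  moreover have "\<forall>\<^sub>F y in at_right x. y \<in> {x<..<b}"
    using x by (intro eventually_at_right_real) auto
  ultimately have "\<forall>\<^sub>F y in at_right x. False"
  proof eventually_elim
    case (elim y)
    then have "g x < g y" using x by (intro strict_mono_onD[OF mono]) auto
    then show ?case using elim by simp
  qed
  then show False by simp
qed

lemma strict_mono_on_not_local_minimum_on:
  fixes g :: "real \<Rightarrow> real"
  assumes x: "x \<in> {a<..<b}" and sub: "{a<..<b} \<subseteq> S" and mono: "strict_mono_on {a<..<b} g"
  shows "\<not> local_minimum_on S g x"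
proof
  assume "local_minimum_on S g x"
  then have ev: "\<forall>\<^sub>F y in at x within S. g x \<le> g y"
    by (simp add: local_minimum_on_def)
  have "x \<in> interior S"
    using x sub by (meson interior_maximal open_greaterThanLessThan subsetD)
  then have "\<forall>\<^sub>F y in at_left x. g x \<le> g y"
    using ev by (metis at_within_interior at_le filter_leD top_greatest)
  moreover have "\<forall>\<^sub>F y in at_left x. y \<in> {a<..<x}"
    using x by (intro eventually_at_left_real) auto
  ultimately have "\<forall>\<^sub>F y in at_left x. False"
  proof eventually_elim
    case (elim y)
    then have "g y < g x" using x by (intro strict_mono_onD[OF mono]) auto
    then show ?case using elim by simp
  qed
  then show False by simp
qed

lemma saddle_point_onI_strict_mono:
  fixes g :: "real \<Rightarrow> real"
  assumes "critical_point_on S g x" "x \<in> {a<..<b}" "{a<..<b} \<subseteq> S" "strict_mono_on {a<..<b} g"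
  shows "saddle_point_on S g x"
  using assms strict_mono_on_not_local_maximum_on strict_mono_on_not_local_minimum_on
  by (metis saddle_point_on_def)

text \<open>Passing to \<open>- g\<close> exchanges maxima with minima and reduces this to the
  increasing case.\<close>

lemma saddle_point_onI_strict_antimono:
  fixes g :: "real \<Rightarrow> real"
  assumes "critical_point_on S g x" "x \<in> {a<..<b}" "{a<..<b} \<subseteq> S"
    "strict_antimono_on {a<..<b} g"
  shows "saddle_point_on S g x"
proof -
  have "strict_mono_on {a<..<b} (\<lambda>q. - g q)"
    using assms(4) by (auto simp: monotone_on_def)
  then show ?thesis
    using assms(1-3) strict_mono_on_not_local_maximum_on[of x a b S "\<lambda>q. - g q"]
      strict_mono_on_not_local_minimum_on[of x a b S "\<lambda>q. - g q"]
    unfolding saddle_point_on_def local_minimum_on_iff_maximum_uminus[of S g]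
      local_maximum_on_iff_minimum_uminus[of S g]
    by blast
qed

section \<open>Unimodal functions and the shape of \<open>q powr a * (1 - q)\<close>\<close>

text \<open>The intermediate value theorem gives one solution on each side of the peak, and strict
  monotonicity makes it the only one there. All three comparisons with \<open>c\<close> are recorded
  because the sign of \<open>f'\<close> is later read off from them.\<close>

lemma unimodal_level_set:
  fixes u :: "real \<Rightarrow> real"
  assumes cont: "continuous_on {a..b} u" and m: "a < m" "m < b"
    and inc: "strict_mono_on {a..m} u" and dec: "strict_antimono_on {m..b} u"
    and c: "u a < c" "u b < c" "c < u m"
  obtains l r where "a < l" "l < m" "m < r" "r < b"
    "\<And>q. q \<in> {a..b} \<Longrightarrow> u q < c \<longleftrightarrow> q < l \<or> r < q"
    "\<And>q. q \<in> {a..b} \<Longrightarrow> c < u q \<longleftrightarrow> l < q \<and> q < r"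
    "\<And>q. q \<in> {a..b} \<Longrightarrow> u q = c \<longleftrightarrow> q = l \<or> q = r"
proof -
  obtain l where l: "a \<le> l" "l \<le> m" "u l = c"
    using IVT'[of u a c m] c m continuous_on_subset[OF cont, of "{a..m}"] by fastforce
  obtain r where r: "m \<le> r" "r \<le> b" "u r = c"
    using IVT2'[of u b c m] c m continuous_on_subset[OF cont, of "{m..b}"] by fastforce
  have less: "a < l" "l < m" "m < r" "r < b"
    using l r c by (auto simp: less_le)
  have L: "(u q < c \<longleftrightarrow> q < l) \<and> (c < u q \<longleftrightarrow> l < q)" if "q \<in> {a..m}" for q
    using strict_mono_onD[OF inc, of q l] strict_mono_onD[OF inc, of l q] that l
    by (cases q l rule: linorder_cases) auto
  have R: "(u q < c \<longleftrightarrow> r < q) \<and> (c < u q \<longleftrightarrow> q < r)" if "q \<in> {m..b}" for q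
    using monotone_onD[OF dec, of q r] monotone_onD[OF dec, of r q] that r
    by (cases q r rule: linorder_cases) auto
  show thesis
  proof (rule that[OF less])
    fix q assume q: "q \<in> {a..b}"
    show "u q < c \<longleftrightarrow> q < l \<or> r < q" "c < u q \<longleftrightarrow> l < q \<and> q < r"
      using L[of q] R[of q] q less by (cases "q \<le> m"; force)+
    then show "u q = c \<longleftrightarrow> q = l \<or> q = r"
      using less by (cases "u q" c rule: linorder_cases) auto
  qed
qed

text \<open>The derivative is \<open>z powr (a - 1) * (a * (1 - z) - z)\<close>, which changes sign
  exactly at \<open>a / (a + 1)\<close>. For \<open>a = p / 2 - 1\<close> this point is
  \<open>(p - 2) / p\<close>.\<close>

lemma strict_mono_on_powr_times_one_minus:
  fixes a :: real
  assumes "a > 0"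
  shows "strict_mono_on {0..a / (a + 1)} (\<lambda>q. q powr a * (1 - q))"
proof (rule strict_mono_onI)
  fix x y assume xy: "x \<in> {0..a / (a + 1)}" "y \<in> {0..a / (a + 1)}" "x < y"
  show "x powr a * (1 - x) < y powr a * (1 - y)"
  proof (rule DERIV_pos_imp_increasing_open[OF \<open>x < y\<close>])
    show "\<exists>d. ((\<lambda>q. q powr a * (1 - q)) has_real_derivative d) (at z) \<and> 0 < d"
      if z: "x < z" "z < y" for z
    proof (intro exI conjI)
      have "0 < z" "z < a / (a + 1)" using z xy by auto
      then have "z * (a + 1) < a" using assms by (simp add: pos_less_divide_eq)
      then have "0 < a * (1 - z) - z" by (simp add: algebra_simps)
      then show "0 < z powr (a - 1) * (a * (1 - z) - z)"
        using \<open>0 < z\<close> by simp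
      have "z powr a = z powr (a - 1) * z"
        using \<open>0 < z\<close> by (simp add: powr_diff)
      then show "((\<lambda>q. q powr a * (1 - q)) has_real_derivative z powr (a - 1) * (a * (1 - z) - z)) (at z)"
        using \<open>0 < z\<close> by (auto intro!: derivative_eq_intros simp: algebra_simps)
    qed
    show "continuous_on {x..y} (\<lambda>q. q powr a * (1 - q))"
      using assms xy by (intro continuous_intros continuous_on_powr') auto
  qed
qed

lemma strict_antimono_on_powr_times_one_minus:
  fixes a :: real
  assumes "a > 0"
  shows "strict_antimono_on {a / (a + 1)..1} (\<lambda>q. q powr a * (1 - q))"
proof (rule monotone_onI)
  fix x y assume xy: "x \<in> {a / (a + 1)..1}" "y \<in> {a / (a + 1)..1}" "x < y"
  have a1: "0 < a / (a + 1)" using assms by simp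
  show "x powr a * (1 - x) > y powr a * (1 - y)"
  proof (rule DERIV_neg_imp_decreasing_open[OF \<open>x < y\<close>])
    show "\<exists>d. ((\<lambda>q. q powr a * (1 - q)) has_real_derivative d) (at z) \<and> d < 0"
      if z: "x < z" "z < y" for z
    proof (intro exI conjI)
      have "a / (a + 1) < z" using z xy by auto
      then have "a < z * (a + 1)" "0 < z"
        using assms less_trans[OF a1] by (simp_all add: pos_divide_less_eq)
      then have "a * (1 - z) - z < 0" by (simp add: algebra_simps)
      then show "z powr (a - 1) * (a * (1 - z) - z) < 0"
        using \<open>0 < z\<close> by (simp add: mult_less_0_iff)
      have "z powr a = z powr (a - 1) * z"
        using \<open>0 < z\<close> by (simp add: powr_diff)
      then show "((\<lambda>q. q powr a * (1 - q)) has_real_derivative z powr (a - 1) * (a * (1 - z) - z)) (at z)"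
        using \<open>0 < z\<close> by (auto intro!: derivative_eq_intros simp: algebra_simps)
    qed
    show "continuous_on {x..y} (\<lambda>q. q powr a * (1 - q))"
      using assms xy less_le_trans[OF a1, of x] by (intro continuous_intros continuous_on_powr') auto
  qed
qed

section \<open>The profile \<open>u\<close> and the derivative of the free energy\<close>

text \<open>This is \<open>u\<close> of the overview. For \<open>q \<ge> 0\<close> its square is
  \<open>\<beta>\<^sup>2 * (1 - q)\<^sup>2\<close> times the second derivative of
  \<open>q ^ p\<close>.\<close>

definition profile :: "nat \<Rightarrow> real \<Rightarrow> real \<Rightarrow> real" where
  "profile p \<beta> q = \<beta> * sqrt (real p * (real p - 1)) * (q powr (real p / 2 - 1) * (1 - q))"

lemma profile_nonneg: "0 \<le> \<beta> \<Longrightarrow> 0 \<le> q \<Longrightarrow> q \<le> 1 \<Longrightarrow> p \<ge> 1 \<Longrightarrow> 0 \<le> profile p \<beta> q"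
  by (simp add: profile_def)

lemma profile_0 [simp]: "profile p \<beta> 0 = 0"
  by (simp add: profile_def)

lemma profile_1 [simp]: "profile p \<beta> 1 = 0"
  by (simp add: profile_def)

text \<open>The point 0 is treated apart: there \<open>powr\<close> is 0 by convention, and
  \<open>0 ^ (p - 2)\<close> is 0 because \<open>p - 2\<close> is at least 1.\<close>

lemma powr_half_minus_one_square:
  assumes "p \<ge> 3" "0 \<le> (q::real)"
  shows "(q powr (real p / 2 - 1))\<^sup>2 = q ^ (p - 2)"
proof (cases "q = 0")
  case True
  then show ?thesis using assms by simp
next
  case False
  then have "(q powr (real p / 2 - 1))\<^sup>2 = q powr ((real p / 2 - 1) + (real p / 2 - 1))"
    by (simp only: power2_eq_square powr_add if_False)
  also have "(real p / 2 - 1) + (real p / 2 - 1) = real (p - 2)"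
    using assms by simp
  also have "q powr real (p - 2) = q ^ (p - 2)"
    using False assms by (intro powr_realpow) auto
  finally show ?thesis .
qed

lemma profile_square:
  assumes "p \<ge> 3" "0 \<le> q"
  shows "(profile p \<beta> q)\<^sup>2 = \<beta>\<^sup>2 * (real p * (real p - 1)) * q ^ (p - 2) * (1 - q)\<^sup>2"
  using assms by (simp add: profile_def power_mult_distrib powr_half_minus_one_square)

lemma continuous_on_profile:
  assumes "p \<ge> 3"
  shows "continuous_on {0..} (profile p \<beta>)"
  unfolding profile_def using assms
  by (intro continuous_intros continuous_on_powr') auto

text \<open>The profile is linear in \<open>\<beta>\<close>, so \<open>\<beta> = 1\<close> suffices.
  There both sides are nonnegative, and comparing squares removes the square roots.\<close>

lemma profile_max:
  assumes p: "p \<ge> 3"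
  shows "profile p \<beta> ((real p - 2) / real p) = \<beta> / beta_c p"
proof -
  let ?q = "(real p - 2) / real p"
  have q: "0 \<le> ?q" "?q \<le> 1" "1 - ?q = 2 / real p" using p by (auto simp: field_simps)
  have "p - 1 = Suc (p - 2)" using p by simp
  then have pw: "real p ^ (p - 1) = real p * real p ^ (p - 2)" by simp
  have "profile p 1 ?q = 1 / beta_c p"
  proof (rule power2_eq_imp_eq)
    have "(1 / beta_c p)\<^sup>2 = 4 * ((real p - 1) * (real p - 2) ^ (p - 2)) / real p ^ (p - 1)"
      using p by (simp add: beta_c_def power_divide field_simps)
    also have "\<dots> = (profile p 1 ?q)\<^sup>2"
      unfolding profile_square[OF p q(1)] q(3) pw using p
      by (simp add: power_divide power2_eq_square field_simps)
    finally show "(profile p 1 ?q)\<^sup>2 = (1 / beta_c p)\<^sup>2" by simp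
    show "0 \<le> profile p 1 ?q" using q p by (intro profile_nonneg) auto
    show "0 \<le> 1 / beta_c p" using p by (simp add: beta_c_def)
  qed
  moreover have "profile p \<beta> ?q = \<beta> * profile p 1 ?q"
    by (simp add: profile_def)
  ultimately show ?thesis by simp
qed

text \<open>The endpoint 0 belongs to the domain of \<open>f\<close>, so the one-sided derivative
  there is needed. At 0 the difference quotient is \<open>y powr (a - 1)\<close>, which tends to 0
  since \<open>a > 1\<close>.\<close>

lemma has_real_derivative_powr_atLeast_0:
  fixes a :: real
  assumes a: "a > 1" and q: "0 \<le> q" and S: "S \<subseteq> {0..}"
  shows "((\<lambda>q. q powr a) has_real_derivative a * q powr (a - 1)) (at q within S)"
proof (cases "q = 0")
  case False
  then show ?thesis
    using q by (intro has_field_derivative_at_within[OF has_real_derivative_powr]) auto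
next
  case True
  have ev: "\<forall>\<^sub>F y in at 0 within S. 0 \<le> y \<and> y \<noteq> 0"
    unfolding eventually_at_filter using S by (intro always_eventually) auto
  have "((\<lambda>y::real. y powr (a - 1)) \<longlongrightarrow> 0 powr (a - 1)) (at 0 within S)"
    using a ev by (intro tendsto_powr' tendsto_intros) (auto elim: eventually_mono)
  then have "((\<lambda>y. y powr (a - 1)) \<longlongrightarrow> 0) (at 0 within S)" by simp
  moreover have "\<forall>\<^sub>F y in at 0 within S. y powr (a - 1) = (y powr a - 0 powr a) / (y - 0)"
    using ev by eventually_elim (simp add: powr_diff)
  ultimately have "((\<lambda>y. (y powr a - 0 powr a) / (y - 0)) \<longlongrightarrow> 0) (at 0 within S)"
    by (rule Lim_transform_eventually)
  then show ?thesis
    using True by (simp add: has_field_derivative_iff)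
qed

lemma has_real_derivative_free_energy:
  assumes p: "p \<ge> 3" and q: "0 \<le> q" "q < 1"
  shows "(free_energy p \<beta> E has_real_derivative
     (2 * (E / E_infty p) * profile p \<beta> q - 1 - (profile p \<beta> q)\<^sup>2) / (2 * (1 - q)))
     (at q within {0..<1})"
proof -
  define n where "n = p - 2"
  have n: "p = n + 2" "p - 1 = Suc n" "p - 2 = n" "n \<ge> 1" using p by (auto simp: n_def)
  define w where "w = q powr (real p / 2 - 1)"
  \<comment> \<open>In this form the square root cancels against the one in
    \<open>E_infty p\<close>, leaving the factor \<open>p / 2\<close>.\<close>
  have sq: "sqrt (real p * (real p - 1)) = real p * sqrt ((real p - 1) / real p)"
  proof (rule real_sqrt_unique)
    show "(real p * sqrt ((real p - 1) / real p))\<^sup>2 = real p * (real p - 1)"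
      using p by (simp add: power_mult_distrib) (simp add: power2_eq_square)
  qed (use p in auto)
  have lin: "2 * (E / E_infty p) * profile p \<beta> q = real p * \<beta> * E * w * (1 - q)"
    using p unfolding E_infty_def profile_def sq w_def by (simp add: field_simps)
  \<comment> \<open>The two contributions \<open>p * q ^ (p - 1)\<close> cancel, so that only the
    term with the second derivative of \<open>q ^ p\<close> survives.\<close>
  have P: "((\<lambda>q. 1 - real p * (1 - q) * q ^ Suc n - q ^ Suc (Suc n)) has_real_derivative
      - (real p * (real p - 1) * (1 - q) * q ^ n)) (at q within {0..<1})"
    unfolding n(1)
    by (rule derivative_eq_intros refl | simp)+ (simp add: algebra_simps)
  have L: "((\<lambda>q. ln (1 - q)) has_real_derivative - (1 / (1 - q))) (at q within {0..<1})"
    using q by (auto intro!: derivative_eq_intros)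
  have D: "((\<lambda>q. q powr (real p / 2)) has_real_derivative real p / 2 * w) (at q within {0..<1})"
    unfolding w_def using p q by (intro has_real_derivative_powr_atLeast_0) auto
  have "((\<lambda>q. \<beta> * q powr (real p / 2) * E + 1 / 2 * ln (1 - q)
           + \<beta>\<^sup>2 / 2 * (1 - real p * (1 - q) * q ^ Suc n - q ^ Suc (Suc n))) has_real_derivative
     \<beta> * (real p / 2 * w) * E + 1 / 2 * (- (1 / (1 - q)))
       + \<beta>\<^sup>2 / 2 * (- (real p * (real p - 1) * (1 - q) * q ^ n))) (at q within {0..<1})"
    by (intro DERIV_add DERIV_cmult DERIV_cmult_right D L P)
  also have "\<beta> * (real p / 2 * w) * E + 1 / 2 * (- (1 / (1 - q)))
       + \<beta>\<^sup>2 / 2 * (- (real p * (real p - 1) * (1 - q) * q ^ n))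
     = (2 * (E / E_infty p) * profile p \<beta> q - 1 - (profile p \<beta> q)\<^sup>2) / (2 * (1 - q))"
    unfolding lin profile_square[OF p q(1)] n(3) using q
    by (simp add: divide_simps) (simp add: algebra_simps power2_eq_square)
  also have "(\<lambda>q. \<beta> * q powr (real p / 2) * E + 1 / 2 * ln (1 - q)
           + \<beta>\<^sup>2 / 2 * (1 - real p * (1 - q) * q ^ Suc n - q ^ Suc (Suc n))) = free_energy p \<beta> E"
    by (simp add: free_energy_def fun_eq_iff n(1))
  finally show ?thesis .
qed

section \<open>Points outside \<open>D_set\<close>\<close>

text \<open>The difference of powers is \<open>t - q\<close> times a sum of \<open>n\<close>
  products, each lying between \<open>q ^ (n - 1)\<close> and 1. The lower bound is the tangent
  inequality; the upper one serves to bound the supremum in \<open>A_sup\<close>.\<close>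

lemma power_diff_bounds:
  fixes q t :: real
  assumes "0 \<le> q" "q \<le> t" "t \<le> 1"
  shows "real n * q ^ (n - 1) * (t - q) \<le> t ^ n - q ^ n" "t ^ n - q ^ n \<le> real n * (t - q)"
proof -
  have eq: "t ^ n - q ^ n = (t - q) * (\<Sum>i<n. q ^ (n - Suc i) * t ^ i)"
    by (rule power_diff_sumr2)
  have "q ^ (n - 1) \<le> q ^ (n - Suc i) * t ^ i" if "i < n" for i
  proof -
    have "q ^ (n - 1) = q ^ (n - Suc i) * q ^ i"
      using that by (simp flip: power_add)
    then show ?thesis using assms by (auto intro!: mult_left_mono power_mono)
  qed
  then have "real n * q ^ (n - 1) \<le> (\<Sum>i<n. q ^ (n - Suc i) * t ^ i)"
    using sum_mono[of "{..<n}" "\<lambda>_. q ^ (n - 1)"] by simp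
  then show "real n * q ^ (n - 1) * (t - q) \<le> t ^ n - q ^ n"
    unfolding eq using assms by (simp add: mult.commute[of "t - q"] mult_right_mono)
  have "(\<Sum>i<n. q ^ (n - Suc i) * t ^ i) \<le> (\<Sum>i<n. 1)"
    using assms by (intro sum_mono mult_le_one power_le_one) auto
  then show "t ^ n - q ^ n \<le> real n * (t - q)"
    unfolding eq using assms by (simp add: mult.commute[of "t - q"] mult_right_mono)
qed

text \<open>By convexity the expression under the supremum is at least \<open>u\<^sup>2 - 1 / (1 - r)\<close>, which is
  positive for small \<open>r\<close>.\<close>

lemma not_in_D_set:
  assumes p: "p \<ge> 3" and q: "0 \<le> q" "q < 1" and u: "1 < profile p \<beta> q"
  shows "q \<notin> D_set p \<beta>"
proof -
  define F where "F r = \<beta>\<^sup>2 * (1 - q) * ((real p * (q + r * (1 - q)) ^ (p - 1) - real p * q ^ (p - 1)) / r)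
        - 1 / (1 - r)" for r
  have t: "q \<le> q + r * (1 - q)" "q + r * (1 - q) \<le> 1" if "0 < r" "r < 1" for r
  proof -
    have "0 \<le> r * (1 - q)" "0 \<le> (1 - r) * (1 - q)"
      using q that by simp_all
    then show "q \<le> q + r * (1 - q)" "q + r * (1 - q) \<le> 1" by (simp_all add: algebra_simps)
  qed
  have F_eq: "F r = \<beta>\<^sup>2 * (1 - q) * real p * (((q + r * (1 - q)) ^ (p - 1) - q ^ (p - 1)) / r) - 1 / (1 - r)" for r
    unfolding F_def right_diff_distrib[symmetric] by simp
  have pos: "0 \<le> \<beta>\<^sup>2 * (1 - q) * real p" using q by simp
  \<comment> \<open>A real-valued \<open>SUP\<close> dominates its members only over a set that is
    bounded above; this supplies the bound.\<close>
  have up: "F r \<le> \<beta>\<^sup>2 * (1 - q) * real p * (real (p - 1) * (1 - q))" if r: "r \<in> {0<..<1}" for r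
  proof -
    have "((q + r * (1 - q)) ^ (p - 1) - q ^ (p - 1)) / r \<le> real (p - 1) * (1 - q)"
      using power_diff_bounds(2)[OF q(1) t[of r], of "p - 1"] r
      by (simp add: pos_divide_le_eq mult_ac)
    then have "\<beta>\<^sup>2 * (1 - q) * real p * (((q + r * (1 - q)) ^ (p - 1) - q ^ (p - 1)) / r)
      \<le> \<beta>\<^sup>2 * (1 - q) * real p * (real (p - 1) * (1 - q))"
      using pos by (rule mult_left_mono)
    moreover have "0 \<le> 1 / (1 - r)" using r by simp
    ultimately show ?thesis unfolding F_eq by linarith
  qed
  define v where "v = (profile p \<beta> q)\<^sup>2"
  have "1 < v" using u by (simp add: v_def one_less_power)
  then have v: "0 < v" "0 < 1 / v" "1 / v < 1" by simp_all
  \<comment> \<open>Any \<open>r\<close> in \<open>(0, 1 - 1 / v)\<close> satisfies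
    \<open>1 / (1 - r) < v\<close>; the midpoint is taken.\<close>
  define r where "r = (1 - 1 / v) / 2"
  have "2 * r = 1 - 1 / v" by (simp add: r_def)
  then have r: "0 < r" "r < 1" "1 / v < 1 - r" using v(2,3) by linarith+
  then have "1 < (1 - r) * v"
    using v(1) by (simp add: pos_divide_less_eq)
  then have *: "1 / (1 - r) < v"
    using r(2) by (simp add: pos_divide_less_eq mult.commute)
  have p2: "p - 1 - 1 = p - 2" by simp
  have "real (p - 1) * q ^ (p - 2) * (1 - q) \<le> ((q + r * (1 - q)) ^ (p - 1) - q ^ (p - 1)) / r"
    using power_diff_bounds(1)[OF q(1) t[OF r(1,2)], of "p - 1"] r(1) unfolding p2
    by (simp add: pos_le_divide_eq mult_ac)
  then have "\<beta>\<^sup>2 * (1 - q) * real p * (real (p - 1) * q ^ (p - 2) * (1 - q))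
      \<le> \<beta>\<^sup>2 * (1 - q) * real p * (((q + r * (1 - q)) ^ (p - 1) - q ^ (p - 1)) / r)"
    using pos by (rule mult_left_mono)
  moreover have "\<beta>\<^sup>2 * (1 - q) * real p * (real (p - 1) * q ^ (p - 2) * (1 - q)) = v"
    unfolding v_def profile_square[OF p q(1)] using p by (simp add: power2_eq_square)
  ultimately have "0 < F r" unfolding F_eq using * by linarith
  also have "F r \<le> A_sup p q \<beta>"
    unfolding A_sup_def F_def[symmetric]
    using r up by (intro cSUP_upper bdd_aboveI2) auto
  finally show ?thesis by (simp add: D_set_def)
qed

section \<open>Monotonicity and level sets of the profile\<close>

lemma profile_strict_mono:
  assumes p: "p \<ge> 3" and "\<beta> > 0"
  shows "strict_mono_on {0..(real p - 2) / real p} (profile p \<beta>)"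
proof -
  define a where "a = real p / 2 - 1"
  have a: "a > 0" "(real p - 2) / real p = a / (a + 1)"
    using p by (auto simp: a_def field_simps)
  have c: "\<beta> * sqrt (real p * (real p - 1)) > 0" using assms by simp
  show ?thesis
    unfolding a(2) profile_def a_def[symmetric]
    using strict_mono_onD[OF strict_mono_on_powr_times_one_minus[OF a(1)]]
    by (intro strict_mono_onI mult_strict_left_mono c) auto
qed

lemma profile_strict_antimono:
  assumes p: "p \<ge> 3" and "\<beta> > 0"
  shows "strict_antimono_on {(real p - 2) / real p..1} (profile p \<beta>)"
proof -
  define a where "a = real p / 2 - 1"
  have a: "a > 0" "(real p - 2) / real p = a / (a + 1)"
    using p by (auto simp: a_def field_simps)
  have c: "\<beta> * sqrt (real p * (real p - 1)) > 0" using assms by simp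
  show ?thesis
    unfolding a(2) profile_def a_def[symmetric]
    using monotone_onD[OF strict_antimono_on_powr_times_one_minus[OF a(1)]]
    by (intro monotone_onI mult_strict_left_mono c) auto
qed

lemma beta_c_pos: "p \<ge> 3 \<Longrightarrow> beta_c p > 0"
  by (simp add: beta_c_def)

lemma E_infty_pos: "p \<ge> 3 \<Longrightarrow> E_infty p > 0"
  by (simp add: E_infty_def)

lemma profile_less_max:
  assumes p: "p \<ge> 3" and \<beta>: "\<beta> > 0" and q: "q \<in> {0..1}" "q \<noteq> (real p - 2) / real p"
  shows "profile p \<beta> q < \<beta> / beta_c p"
proof -
  have q0: "0 < (real p - 2) / real p" "(real p - 2) / real p < 1" using p by auto
  show ?thesis
    unfolding profile_max[OF p, symmetric]
    using strict_mono_onD[OF profile_strict_mono[OF p \<beta>], of q "(real p - 2) / real p"]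
      monotone_onD[OF profile_strict_antimono[OF p \<beta>], of "(real p - 2) / real p" q] q q0
    by (cases q "(real p - 2) / real p" rule: linorder_cases) auto
qed

lemma profile_le_max:
  assumes p: "p \<ge> 3" and \<beta>: "\<beta> \<ge> 0" and q: "q \<in> {0..1}"
  shows "profile p \<beta> q \<le> \<beta> / beta_c p"
proof (cases "\<beta> = 0 \<or> q = (real p - 2) / real p")
  case True
  then show ?thesis using profile_max[OF p, of \<beta>] by (auto simp: profile_def)
next
  case False
  then show ?thesis using profile_less_max[OF p, of \<beta> q] \<beta> q by auto
qed

lemma profile_level_set:
  assumes p: "p \<ge> 3" and c: "0 < c" "c < \<beta> / beta_c p"
  obtains l r where "0 < l" "l < (real p - 2) / real p" "(real p - 2) / real p < r" "r < 1"
    "\<And>q. q \<in> {0..1} \<Longrightarrow> profile p \<beta> q < c \<longleftrightarrow> q < l \<or> r < q"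
    "\<And>q. q \<in> {0..1} \<Longrightarrow> c < profile p \<beta> q \<longleftrightarrow> l < q \<and> q < r"
    "\<And>q. q \<in> {0..1} \<Longrightarrow> profile p \<beta> q = c \<longleftrightarrow> q = l \<or> q = r"
proof -
  \<comment> \<open>A positive level below the maximum forces \<open>\<beta> > 0\<close>, as strict
    monotonicity requires.\<close>
  have "0 < \<beta> / beta_c p" using c by simp
  then have \<beta>: "\<beta> > 0" using beta_c_pos[OF p] by (simp add: zero_less_divide_iff)
  have cont: "continuous_on {0..1} (profile p \<beta>)"
    using continuous_on_profile[OF p] by (rule continuous_on_subset) auto
  have m: "0 < (real p - 2) / real p" "(real p - 2) / real p < 1" using p by auto
  have "profile p \<beta> 0 < c" "profile p \<beta> 1 < c" "c < profile p \<beta> ((real p - 2) / real p)"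
    using c profile_max[OF p, of \<beta>] by simp_all
  from unimodal_level_set[OF cont m profile_strict_mono[OF p \<beta>] profile_strict_antimono[OF p \<beta>] this that]
  show thesis .
qed

section \<open>Points inside \<open>D_set\<close>\<close>

text \<open>As \<open>u\<close> decreases beyond \<open>q\<close>, \<open>s ^ (p - 2) \<le> q ^ (p - 2) * (1 - q)\<^sup>2 / (1 - s)\<^sup>2\<close>; integrating this
  over \<open>q \<le> s \<le> q + r (1 - q)\<close> bounds the expression under the supremum by \<open>(u\<^sup>2 - 1) / (1 - r)\<close>.\<close>

lemma in_D_set:
  assumes p: "p \<ge> 3" and q: "(real p - 2) / real p \<le> q" "q < 1" and u: "(profile p \<beta> q)\<^sup>2 \<le> 1"
  shows "q \<in> D_set p \<beta>"
proof -
  have "0 < (real p - 2) / real p" using p by simp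
  then have q0: "0 < q" using q by linarith
  \<comment> \<open>Chosen so that \<open>\<beta>\<^sup>2 * p * K\<close> is the square of the
    profile at \<open>q\<close>, and so that \<open>K / (1 - s)\<^sup>2\<close> dominates the
    derivative of \<open>s ^ (p - 1)\<close> for \<open>q \<le> s < 1\<close>.\<close>
  define K where "K = (real p - 1) * (q ^ (p - 2) * (1 - q)\<^sup>2)"
  have K: "\<beta>\<^sup>2 * real p * K \<le> 1"
    using u q0 by (simp add: K_def profile_square[OF p] mult_ac)
  have dec: "s ^ (p - 2) * (1 - s)\<^sup>2 \<le> q ^ (p - 2) * (1 - q)\<^sup>2" if s: "q \<le> s" "s \<le> 1" for s
  proof -
    \<comment> \<open>The inequality does not involve \<open>\<beta>\<close>. With
      \<open>\<beta> = 1\<close> the profile is strictly decreasing here.\<close>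
    have "profile p 1 s \<le> profile p 1 q"
      using monotone_onD[OF profile_strict_antimono[OF p], of 1 q s] s q by (cases "s = q") auto
    moreover have "0 \<le> profile p 1 s" using p s q0 by (intro profile_nonneg) auto
    ultimately have "(profile p 1 s)\<^sup>2 \<le> (profile p 1 q)\<^sup>2" by (rule power_mono)
    moreover have "0 < real p * (real p - 1)" using p by simp
    ultimately show ?thesis
      using p s q0 by (simp add: profile_square mult.assoc)
  qed
  have "\<beta>\<^sup>2 * (1 - q) * ((real p * (q + r * (1 - q)) ^ (p - 1) - real p * q ^ (p - 1)) / r)
      - 1 / (1 - r) \<le> 0" if r: "r \<in> {0<..<1}" for r
  proof -
    define t where "t = q + r * (1 - q)"
    have "0 < r * (1 - q)" "0 < (1 - r) * (1 - q)" using r q by simp_all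
    then have t: "q < t" "t < 1" by (simp_all add: t_def algebra_simps)
    have t1: "1 - t = (1 - r) * (1 - q)" by (simp add: t_def algebra_simps)
    \<comment> \<open>The integrated form of the domination: \<open>K / (1 - s)\<close> is an
      antiderivative of \<open>K / (1 - s)\<^sup>2\<close>, so its difference with
      \<open>s ^ (p - 1)\<close> is nondecreasing.\<close>
    have "K / (1 - q) - q ^ (p - 1) \<le> K / (1 - t) - t ^ (p - 1)"
    proof (rule DERIV_nonneg_imp_nondecreasing[where f = "\<lambda>s. K / (1 - s) - s ^ (p - 1)"])
      show "q \<le> t" using t by simp
      fix s assume s: "q \<le> s" "s \<le> t"
      have s1: "s < 1" using s t by simp
      show "\<exists>y. ((\<lambda>s. K / (1 - s) - s ^ (p - 1)) has_real_derivative y) (at s) \<and> 0 \<le> y"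
      proof (intro exI conjI)
        have "((\<lambda>s. K / (1 - s)) has_real_derivative K / (1 - s)\<^sup>2) (at s)"
          using s1 by (auto intro!: derivative_eq_intros simp: power2_eq_square)
        moreover have "((\<lambda>s. s ^ (p - 1)) has_real_derivative (real p - 1) * s ^ (p - 2)) (at s)"
          using DERIV_pow[of "p - 1" s UNIV] p by (simp add: numeral_2_eq_2)
        ultimately show "((\<lambda>s. K / (1 - s) - s ^ (p - 1)) has_real_derivative
            K / (1 - s)\<^sup>2 - (real p - 1) * s ^ (p - 2)) (at s)"
          by (rule DERIV_diff)
        have "(real p - 1) * (s ^ (p - 2) * (1 - s)\<^sup>2) \<le> K"
          unfolding K_def using dec[of s] s s1 p by (intro mult_left_mono) auto
        then have "(real p - 1) * s ^ (p - 2) \<le> K / (1 - s)\<^sup>2"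
          using s1 by (simp add: pos_le_divide_eq mult.assoc)
        then show "0 \<le> K / (1 - s)\<^sup>2 - (real p - 1) * s ^ (p - 2)" by simp
      qed
    qed
    then have "t ^ (p - 1) - q ^ (p - 1) \<le> K / (1 - t) - K / (1 - q)" by linarith
    also have "\<dots> = K * r / ((1 - r) * (1 - q))"
      unfolding t1 using r q by (simp add: divide_simps) (simp add: algebra_simps)
    finally have "\<beta>\<^sup>2 * (1 - q) * real p / r * (t ^ (p - 1) - q ^ (p - 1))
        \<le> \<beta>\<^sup>2 * (1 - q) * real p / r * (K * r / ((1 - r) * (1 - q)))"
      using r q by (intro mult_left_mono) auto
    also have "\<dots> = \<beta>\<^sup>2 * real p * K / (1 - r)"
      using r q by (simp add: divide_simps)
    also have "\<dots> \<le> 1 / (1 - r)"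
      using K r by (intro divide_right_mono) auto
    finally show ?thesis
      unfolding t_def[symmetric] right_diff_distrib[symmetric] by (simp add: mult_ac)
  qed
  then have "A_sup p q \<beta> \<le> 0"
    unfolding A_sup_def by (intro cSUP_least) auto
  then show ?thesis using q q0 by (simp add: D_set_def)
qed

section \<open>Classification of the critical points\<close>

text \<open>Every point of \<open>[0, 1)\<close> is a limit point of that set, so derivatives
  relative to it are unique, and the positive denominator \<open>2 * (1 - q)\<close> does not affect
  the zeros.\<close>

lemma critical_points_free_energy_iff:
  assumes p: "p \<ge> 3"
  shows "q \<in> critical_points (free_energy p \<beta> E) \<longleftrightarrow>
    q \<in> {0..<1} \<and> 2 * (E / E_infty p) * profile p \<beta> q - 1 - (profile p \<beta> q)\<^sup>2 = 0"
proof (cases "q \<in> {0..<1}")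
  case True
  then have q: "0 \<le> q" "q < 1" by auto
  have "q islimpt {0..<1}"
    using islimpt_greaterThanLessThan1[OF q(2)] by (rule islimpt_subset) (use q in auto)
  then have ntriv: "at q within {0..<1} \<noteq> bot"
    by (simp add: trivial_limit_within)
  note D = has_real_derivative_free_energy[OF p q, of \<beta> E]
  have "(2 * (E / E_infty p) * profile p \<beta> q - 1 - (profile p \<beta> q)\<^sup>2) / (2 * (1 - q)) = 0"
    if "(free_energy p \<beta> E has_real_derivative 0) (at q within {0..<1})"
    using tendsto_unique[OF ntriv D[unfolded has_field_derivative_iff] that[unfolded has_field_derivative_iff]] .
  with D q show ?thesis
    by (auto simp: critical_points_def critical_point_on_def)
qed (auto simp: critical_points_def critical_point_on_def)

theorem theorem4p4:
  fixes p :: nat and \<beta> E :: real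
  assumes "p \<ge> 3" and "\<beta> \<ge> 0"
  defines "f \<equiv> free_energy p \<beta> E"
    and "q0 \<equiv> (real p - 2) / real p"
    and "b \<equiv> \<beta> / beta_c p"
    and "x \<equiv> E / E_infty p"
  shows
    "(E < E_infty p \<longrightarrow> strict_antimono_on {0..<1} f \<and> critical_points f = {}) \<and>
     (E > E_infty p \<longrightarrow>
        (b < r_minus x \<longrightarrow> critical_points f = {}) \<and>
        (b = r_minus x \<longrightarrow> critical_points f = {q0} \<and> saddle_point f q0) \<and>
        (r_minus x < b \<and> b < r_plus x \<longrightarrow>
           (\<exists>q1 q2. critical_points f = {q1, q2} \<and> card {q1, q2} = 2 \<and>
              local_maximum f q1 \<and> q1 \<in> D_set p \<beta> \<inter> {q0<..<1} \<and>
              local_minimum f q2 \<and> q2 \<in> {0<..<q0})) \<and>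
        (b = r_plus x \<longrightarrow>
           (\<exists>q1 q2. critical_points f = {q1, q2, q0} \<and> card {q1, q2, q0} = 3 \<and>
              local_maximum f q1 \<and> q1 \<in> D_set p \<beta> \<inter> {q0<..<1} \<and>
              local_minimum f q2 \<and> q2 \<in> {0<..<q0} \<and>
              saddle_point f q0)) \<and>
        (b > r_plus x \<longrightarrow>
           (\<exists>q1 q2 q3 q4. critical_points f = {q1, q2, q3, q4} \<and> card {q1, q2, q3, q4} = 4 \<and>
              local_maximum f q1 \<and> q1 \<in> {0<..<q0} \<and> q1 \<notin> D_set p \<beta> \<and>
              local_minimum f q2 \<and> q2 \<in> {0<..<q0} \<and>
              local_maximum f q3 \<and> q3 \<in> {q0<..<1} \<and> q3 \<in> D_set p \<beta> \<and>
              local_minimum f q4 \<and> q4 \<in> {q0<..<1} \<and> q4 \<notin> D_set p \<beta>))) \<and>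
     (E = E_infty p \<longrightarrow>
        r_plus x = 1 \<and> r_minus x = 1 \<and>
        strict_antimono_on {0..<1} f \<and>
        (b < 1 \<longrightarrow> critical_points f = {}) \<and>
        (b = 1 \<longrightarrow> critical_points f = {q0} \<and> saddle_point f q0) \<and>
        (b > 1 \<longrightarrow>
           (\<exists>q1 q2. critical_points f = {q1, q2} \<and> card {q1, q2} = 2 \<and>
              saddle_point f q1 \<and> q1 \<in> {q0<..<1} \<and>
              saddle_point f q2 \<and> q2 \<in> {0<..<q0})))"
proof -
  note p = assms(1) and \<beta> = assms(2)
  define u where "u = profile p \<beta>"
  define D where "D q = (2 * x * u q - 1 - (u q)\<^sup>2) / (2 * (1 - q))" for q
  have Epos: "E_infty p > 0" using E_infty_pos[OF p] .
  have q0: "0 < q0" "q0 < 1" using p by (simp_all add: q0_def)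
  have der: "(f has_real_derivative D q) (at q within {0..<1})" if "q \<in> {0..<1}" for q
    using has_real_derivative_free_energy[OF p, of q \<beta> E] that
    by (simp add: f_def D_def u_def x_def)
  have u_nonneg: "0 \<le> u q" if "q \<in> {0..<1}" for q
    using profile_nonneg[OF \<beta>] that p by (simp add: u_def)
  have u_le: "u q \<le> b" if "q \<in> {0..<1}" for q
    using profile_le_max[OF p \<beta>] that by (simp add: u_def b_def)
  have crit: "q \<in> critical_points f \<longleftrightarrow> q \<in> {0..<1} \<and> D q = 0" for q
    using critical_points_free_energy_iff[OF p, of q \<beta> E]
    by (auto simp: f_def D_def u_def x_def)
  have crit_D: "critical_points f = {q \<in> {0..<1}. D q = 0}"
    using crit by blast
  have anti: "strict_antimono_on {0..<1} f"
    if "\<And>q. q \<in> {0..<1} \<Longrightarrow> D q \<le> 0" "finite (critical_points f)"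
    using strict_antimono_on_deriv_nonpos_finite_zeros[of "{0..<1}" f D] der that
    by (auto simp: is_interval_co crit_D)
  \<comment> \<open>The condition \<open>0 < q\<close> matters: at the endpoint 0 a decreasing
    function has a one-sided local maximum.\<close>
  have anti_saddle: "saddle_point f q"
    if "strict_antimono_on {0..<1} f" "q \<in> critical_points f" "0 < q" for q
  proof (rule saddle_point_onI_strict_antimono[of _ _ _ 0 1])
    show "strict_antimono_on {0<..<1} f"
      using that(1) by (rule monotone_on_subset) auto
  qed (use that in \<open>auto simp: critical_points_def critical_point_on_def\<close>)
  have beta_pos: "\<beta> > 0" if "b > 0"
    using that beta_c_pos[OF p] \<beta> by (cases "\<beta> = 0") (auto simp: b_def)
  have u_q0: "u q0 = b"
    using profile_max[OF p, of \<beta>] by (simp add: u_def q0_def b_def)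
  have u_less: "u q < b" if "b > 0" "q \<in> {0..<1}" "q \<noteq> q0" for q
    using profile_less_max[OF p beta_pos[OF that(1)], of q] that by (simp add: u_def q0_def b_def)
  have u_eq_b: "u q = b \<longleftrightarrow> q = q0" if "b > 0" "q \<in> {0..<1}" for q
    using u_less[OF that] u_q0 by (metis less_irrefl)
  have level: "\<exists>l r. 0 < l \<and> l < q0 \<and> q0 < r \<and> r < 1 \<and>
      (\<forall>q\<in>{0..1}. (u q < c \<longleftrightarrow> q < l \<or> r < q) \<and> (c < u q \<longleftrightarrow> l < q \<and> q < r) \<and>
        (u q = c \<longleftrightarrow> q = l \<or> q = r))" if c: "0 < c" "c < b" for c
    by (rule profile_level_set[OF p c(1) c(2)[unfolded b_def]]) (auto simp: u_def q0_def)

  have case1: "strict_antimono_on {0..<1} f \<and> critical_points f = {}" if "E < E_infty p"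
  proof -
    have "x < 1" using that Epos by (simp add: x_def)
    have neg: "D q < 0" if q: "q \<in> {0..<1}" for q
    proof -
      \<comment> \<open>Where \<open>u q = 0\<close>, as at \<open>q = 0\<close>, the value is
        \<open>-1\<close>. Elsewhere \<open>x < 1\<close> makes it strictly less than
        \<open>- (u q - 1)\<^sup>2\<close>.\<close>
      have "2 * x * u q - 1 - (u q)\<^sup>2 < 0"
      proof (cases "u q = 0")
        case False
        then have "x * u q < 1 * u q"
          using u_nonneg[OF q] \<open>x < 1\<close> by (intro mult_strict_right_mono) auto
        moreover have "0 \<le> (u q - 1)\<^sup>2" by simp
        then have "2 * u q - 1 - (u q)\<^sup>2 \<le> 0" by (simp add: power2_diff)
        ultimately show ?thesis by simp
      qed simp
      then show ?thesis using q by (simp add: D_def divide_neg_pos)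
    qed
    then have empty: "critical_points f = {}" by (force simp: crit_D)
    show ?thesis using anti neg empty by (simp add: less_imp_le)
  qed

  define rm where "rm = r_minus x"
  define rp where "rp = r_plus x"
  have roots: "rm + rp = 2 * x" "rm * rp = 1" if "x \<ge> 1"
  proof -
    have "x\<^sup>2 - 1 \<ge> 0" using that by simp
    then have "(sqrt (x\<^sup>2 - 1))\<^sup>2 = x\<^sup>2 - 1" by simp
    then show "rm * rp = 1"
      by (simp add: rm_def rp_def r_minus_def r_plus_def algebra_simps power2_eq_square)
    show "rm + rp = 2 * x" by (simp add: rm_def rp_def r_minus_def r_plus_def)
  qed
  \<comment> \<open>For \<open>x \<ge> 1\<close> the quadratic in \<open>u q\<close> has the real
    roots \<open>rm\<close> and \<open>rp\<close>; the derivative is nonnegative between them and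
    nonpositive outside.\<close>
  have D_eq: "D q = (u q - rm) * (rp - u q) / (2 * (1 - q))" if "x \<ge> 1" for q
  proof -
    have "(u q - rm) * (rp - u q) = (rm + rp) * u q - rm * rp - (u q)\<^sup>2"
      by (simp add: algebra_simps power2_eq_square)
    then show ?thesis using roots[OF that] by (simp add: D_def)
  qed

  have case2: "(b < rm \<longrightarrow> critical_points f = {}) \<and>
        (b = rm \<longrightarrow> critical_points f = {q0} \<and> saddle_point f q0) \<and>
        (rm < b \<and> b < rp \<longrightarrow>
           (\<exists>q1 q2. critical_points f = {q1, q2} \<and> card {q1, q2} = 2 \<and>
              local_maximum f q1 \<and> q1 \<in> D_set p \<beta> \<inter> {q0<..<1} \<and>
              local_minimum f q2 \<and> q2 \<in> {0<..<q0})) \<and>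
        (b = rp \<longrightarrow>
           (\<exists>q1 q2. critical_points f = {q1, q2, q0} \<and> card {q1, q2, q0} = 3 \<and>
              local_maximum f q1 \<and> q1 \<in> D_set p \<beta> \<inter> {q0<..<1} \<and>
              local_minimum f q2 \<and> q2 \<in> {0<..<q0} \<and>
              saddle_point f q0)) \<and>
        (b > rp \<longrightarrow>
           (\<exists>q1 q2 q3 q4. critical_points f = {q1, q2, q3, q4} \<and> card {q1, q2, q3, q4} = 4 \<and>
              local_maximum f q1 \<and> q1 \<in> {0<..<q0} \<and> q1 \<notin> D_set p \<beta> \<and>
              local_minimum f q2 \<and> q2 \<in> {0<..<q0} \<and>
              local_maximum f q3 \<and> q3 \<in> {q0<..<1} \<and> q3 \<in> D_set p \<beta> \<and>
              local_minimum f q4 \<and> q4 \<in> {q0<..<1} \<and> q4 \<notin> D_set p \<beta>))" if "E > E_infty p"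
  proof -
    have x: "x > 1" using that Epos by (simp add: x_def)
    have "x\<^sup>2 - 1 > 0" using x by simp
    then have "rm < x" "x < rp" by (simp_all add: rm_def rp_def r_minus_def r_plus_def)
    then have rp: "1 < rp" and rm_rp: "rm < rp" using x by linarith+
    have rm_inv: "rm = 1 / rp" using roots(2) x rp by (simp add: field_simps)
    then have rm: "0 < rm" "rm < 1" using rp by simp_all
    have D_pos: "0 \<le> D q" if "q \<in> {0..<1}" "rm \<le> u q" "u q \<le> rp" for q
      using that x by (simp add: D_eq)
    have D_neg: "D q \<le> 0" if "q \<in> {0..<1}" "u q \<le> rm \<or> rp \<le> u q" for q
    proof -
      have "(u q - rm) * (rp - u q) \<le> 0" using that(2) rm_rp by (auto simp: mult_le_0_iff)
      then show ?thesis using that(1) x by (simp add: D_eq divide_nonpos_pos)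
    qed
    have crit': "q \<in> critical_points f \<longleftrightarrow> q \<in> {0..<1} \<and> (u q = rm \<or> u q = rp)" for q
      using x by (auto simp: crit D_eq)
    \<comment> \<open>The roots are reciprocal, hence \<open>rm < 1 < rp\<close>. Critical points at
      level \<open>rm\<close> to the right of \<open>q0\<close> therefore lie in
      \<open>D_set\<close>, and all those at level \<open>rp\<close> lie outside it.\<close>
    have in_D: "q \<in> D_set p \<beta>" if "q0 \<le> q" "q < 1" "u q = rm" for q
      using in_D_set[OF p, of q \<beta>] that rm by (simp add: q0_def u_def power_le_one)
    have not_in_D: "q \<notin> D_set p \<beta>" if "q \<in> {0..<1}" "u q = rp" for q
      using not_in_D_set[OF p, of q \<beta>] that rp by (simp add: u_def)

    have a: "critical_points f = {}" if "b < rm"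
      using crit' u_le that rm_rp by fastforce
    have b: "critical_points f = {q0} \<and> saddle_point f q0" if "b = rm"
    proof -
      have c: "critical_points f = {q0}"
        using crit' u_le u_eq_b that rm rm_rp q0 by fastforce
      \<comment> \<open>The profile stays at or below \<open>rm\<close>, so \<open>D\<close> is
        nonpositive with its only zero at the peak \<open>q0\<close>.\<close>
      have "strict_antimono_on {0..<1} f"
        using D_neg u_le that c by (intro anti) auto
      then show ?thesis using c anti_saddle q0 by simp
    qed
    \<comment> \<open>Common to the cases (c) and (d): since \<open>b \<le> rp\<close>, the profile
      never exceeds \<open>rp\<close>, and \<open>D\<close> is nonnegative on the whole interval
      between the two points at level \<open>rm\<close>.\<close>
    have cd: "\<exists>q1 q2. q1 \<in> D_set p \<beta> \<inter> {q0<..<1} \<and> q2 \<in> {0<..<q0} \<and>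
        local_maximum f q1 \<and> local_minimum f q2 \<and>
        (\<forall>q\<in>{0..<1}. u q = rm \<longleftrightarrow> q = q1 \<or> q = q2) \<and>
        (\<forall>q\<in>{0..<1}. rm < u q \<longleftrightarrow> q2 < q \<and> q < q1)" if "rm < b" "b \<le> rp"
    proof -
      obtain l r where lr: "0 < l" "l < q0" "q0 < r" "r < 1"
        and less: "\<And>q. q \<in> {0..1} \<Longrightarrow> u q < rm \<longleftrightarrow> q < l \<or> r < q"
        and gr: "\<And>q. q \<in> {0..1} \<Longrightarrow> rm < u q \<longleftrightarrow> l < q \<and> q < r"
        and eq: "\<And>q. q \<in> {0..1} \<Longrightarrow> u q = rm \<longleftrightarrow> q = l \<or> q = r"
        using level[OF rm(1) \<open>rm < b\<close>] by blast
      have pos: "0 \<le> D q" if "l < q" "q < r" for q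
        using D_pos[of q] gr[of q] u_le[of q] \<open>b \<le> rp\<close> that lr by auto
      have neg: "D q \<le> 0" if "q \<in> {0..<1}" "q < l \<or> r < q" for q
        using D_neg[of q] less[of q] that by auto
      have "local_maximum f r"
        by (rule local_maximum_onI[of l r 1 _ f D]) (use lr pos neg der in auto)
      moreover have "local_minimum f l"
        by (rule local_minimum_onI[of 0 l r _ f D]) (use lr pos neg der in auto)
      moreover have "r \<in> D_set p \<beta>"
        using in_D[of r] eq[of r] lr by auto
      ultimately show ?thesis
        using lr eq gr by (intro exI[of _ r] exI[of _ l]) auto
    qed
    have c: "\<exists>q1 q2. critical_points f = {q1, q2} \<and> card {q1, q2} = 2 \<and>
              local_maximum f q1 \<and> q1 \<in> D_set p \<beta> \<inter> {q0<..<1} \<and>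
              local_minimum f q2 \<and> q2 \<in> {0<..<q0}" if "rm < b" "b < rp"
    proof -
      obtain q1 q2 where *: "q1 \<in> D_set p \<beta> \<inter> {q0<..<1}" "q2 \<in> {0<..<q0}"
        "local_maximum f q1" "local_minimum f q2"
        and eq: "\<forall>q\<in>{0..<1}. u q = rm \<longleftrightarrow> q = q1 \<or> q = q2"
        using cd[OF \<open>rm < b\<close> less_imp_le[OF \<open>b < rp\<close>]] by blast
      have "u q \<noteq> rp" if "q \<in> {0..<1}" for q
        using u_le[OF that] \<open>b < rp\<close> by simp
      moreover have "q1 \<in> {0..<1}" "q2 \<in> {0..<1}" using * q0 by auto
      ultimately have "critical_points f = {q1, q2}"
        unfolding set_eq_iff crit' using eq by blast
      moreover have "q1 \<noteq> q2" using * by auto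
      ultimately show ?thesis using * by (intro exI[of _ q1] exI[of _ q2]) simp
    qed
    have d: "\<exists>q1 q2. critical_points f = {q1, q2, q0} \<and> card {q1, q2, q0} = 3 \<and>
              local_maximum f q1 \<and> q1 \<in> D_set p \<beta> \<inter> {q0<..<1} \<and>
              local_minimum f q2 \<and> q2 \<in> {0<..<q0} \<and>
              saddle_point f q0" if "b = rp"
    proof -
      have "rm < b" using rm_rp that by simp
      obtain q1 q2 where *: "q1 \<in> D_set p \<beta> \<inter> {q0<..<1}" "q2 \<in> {0<..<q0}"
        "local_maximum f q1" "local_minimum f q2"
        and eq: "\<forall>q\<in>{0..<1}. u q = rm \<longleftrightarrow> q = q1 \<or> q = q2"
        and gr: "\<forall>q\<in>{0..<1}. rm < u q \<longleftrightarrow> q2 < q \<and> q < q1"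
        using cd[OF \<open>rm < b\<close> eq_refl[OF \<open>b = rp\<close>]] by blast
      have eq_rp: "u q = rp \<longleftrightarrow> q = q0" if "q \<in> {0..<1}" for q
        using u_eq_b[OF _ that] rp \<open>b = rp\<close> by simp
      have "q1 \<in> {0..<1}" "q2 \<in> {0..<1}" "q0 \<in> {0..<1}" using * q0 by auto
      then have crits: "critical_points f = {q1, q2, q0}"
        unfolding set_eq_iff crit' using eq eq_rp by blast
      have sub: "{q2<..<q1} \<subseteq> {0..<1}" using * by auto
      \<comment> \<open>At \<open>b = rp\<close> the profile touches \<open>rp\<close> only at its
        peak, so \<open>D\<close> vanishes at \<open>q0\<close> without changing sign and
        \<open>f\<close> keeps increasing through it.\<close>
      have "strict_mono_on {q2<..<q1} f"
      proof (rule strict_mono_on_deriv_nonneg_finite_zeros[where g' = D])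
        show "(f has_real_derivative D q) (at q within {q2<..<q1})" if "q \<in> {q2<..<q1}" for q
          using der[of q] that sub by (blast intro: has_field_derivative_subset)
        show "0 \<le> D q" if "q \<in> {q2<..<q1}" for q
        proof -
          have q: "q \<in> {0..<1}" using that sub by blast
          then have "rm < u q" using gr that by simp
          then show ?thesis using D_pos[OF q] u_le[OF q] \<open>b = rp\<close> by simp
        qed
        have "{q \<in> {q2<..<q1}. D q = 0} \<subseteq> {q1, q2, q0}"
          using sub unfolding crits[symmetric] crit_D by blast
        then show "finite {q \<in> {q2<..<q1}. D q = 0}" by (rule finite_subset) simp
      qed (simp add: is_interval_oo)
      then have "saddle_point f q0"
        using sub crits * by (intro saddle_point_onI_strict_mono[of _ _ _ q2 q1])
          (auto simp: critical_points_def)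
      moreover have "q1 \<noteq> q2" "q1 \<noteq> q0" "q2 \<noteq> q0" using * by auto
      ultimately show ?thesis using * crits by (intro exI[of _ q1] exI[of _ q2]) simp
    qed
    have e: "\<exists>q1 q2 q3 q4. critical_points f = {q1, q2, q3, q4} \<and> card {q1, q2, q3, q4} = 4 \<and>
              local_maximum f q1 \<and> q1 \<in> {0<..<q0} \<and> q1 \<notin> D_set p \<beta> \<and>
              local_minimum f q2 \<and> q2 \<in> {0<..<q0} \<and>
              local_maximum f q3 \<and> q3 \<in> {q0<..<1} \<and> q3 \<in> D_set p \<beta> \<and>
              local_minimum f q4 \<and> q4 \<in> {q0<..<1} \<and> q4 \<notin> D_set p \<beta>" if "b > rp"
    proof -
      have "rm < b" "0 < rp" using rm_rp rp that by linarith+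
      obtain l r where lr: "0 < l" "l < q0" "q0 < r" "r < 1"
        and less: "\<And>q. q \<in> {0..1} \<Longrightarrow> u q < rm \<longleftrightarrow> q < l \<or> r < q"
        and gr: "\<And>q. q \<in> {0..1} \<Longrightarrow> rm < u q \<longleftrightarrow> l < q \<and> q < r"
        and eq: "\<And>q. q \<in> {0..1} \<Longrightarrow> u q = rm \<longleftrightarrow> q = l \<or> q = r"
        using level[OF rm(1) \<open>rm < b\<close>] by blast
      obtain l' r' where lr': "0 < l'" "l' < q0" "q0 < r'" "r' < 1"
        and less': "\<And>q. q \<in> {0..1} \<Longrightarrow> u q < rp \<longleftrightarrow> q < l' \<or> r' < q"
        and gr': "\<And>q. q \<in> {0..1} \<Longrightarrow> rp < u q \<longleftrightarrow> l' < q \<and> q < r'"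
        and eq': "\<And>q. q \<in> {0..1} \<Longrightarrow> u q = rp \<longleftrightarrow> q = l' \<or> q = r'"
        using level[OF \<open>0 < rp\<close> \<open>b > rp\<close>] by blast
      \<comment> \<open>The superlevel sets of \<open>u\<close> are nested, which gives
        \<open>l < l' < q0 < r' < r\<close>. On the successive intervals cut out by these four
        points \<open>D\<close> is nonpositive, nonnegative, nonpositive, nonnegative,
        nonpositive.\<close>
      have order: "l < l'" "r' < r"
        using gr[of l'] gr[of r'] eq'[of l'] eq'[of r'] lr lr' rm_rp by auto
      have pos: "0 \<le> D q" if "l < q \<and> q < l' \<or> r' < q \<and> q < r" for q
        using D_pos[of q] gr[of q] less'[of q] that lr lr' by auto
      have neg: "D q \<le> 0" if "q \<in> {0..<1}" "q < l \<or> r < q \<or> l' < q \<and> q < r'" for q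
        using D_neg[of q] less[of q] gr'[of q] that by auto
      have "local_maximum f l'"
        by (rule local_maximum_onI[of l l' r' _ f D]) (use lr lr' order pos neg der in auto)
      moreover have "local_minimum f l"
        by (rule local_minimum_onI[of 0 l l' _ f D]) (use lr lr' order pos neg der in auto)
      moreover have "local_maximum f r"
        by (rule local_maximum_onI[of r' r 1 _ f D]) (use lr lr' order pos neg der in auto)
      moreover have "local_minimum f r'"
        by (rule local_minimum_onI[of l' r' r _ f D]) (use lr lr' order pos neg der in auto)
      moreover have "r \<in> D_set p \<beta>"
        using in_D[of r] eq[of r] lr by auto
      moreover have "l' \<notin> D_set p \<beta>" "r' \<notin> D_set p \<beta>"
        using not_in_D[of l'] not_in_D[of r'] eq'[of l'] eq'[of r'] lr' by auto
      moreover have "critical_points f = {l', l, r, r'}"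
      proof -
        have "{l', l, r, r'} \<subseteq> {0..<1}" "{0..<1} \<subseteq> {0..1::real}" using lr lr' by auto
        then show ?thesis unfolding set_eq_iff crit' using eq eq' by blast
      qed
      moreover have "card {l', l, r, r'} = 4"
        using lr lr' order by simp
      ultimately show ?thesis
        using lr lr' by (intro exI[of _ l'] exI[of _ l] exI[of _ r] exI[of _ r']) simp
    qed
    show ?thesis using a b c d e by blast
  qed

  have case3: "rp = 1 \<and> rm = 1 \<and>
        strict_antimono_on {0..<1} f \<and>
        (b < 1 \<longrightarrow> critical_points f = {}) \<and>
        (b = 1 \<longrightarrow> critical_points f = {q0} \<and> saddle_point f q0) \<and>
        (b > 1 \<longrightarrow>
           (\<exists>q1 q2. critical_points f = {q1, q2} \<and> card {q1, q2} = 2 \<and>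
              saddle_point f q1 \<and> q1 \<in> {q0<..<1} \<and>
              saddle_point f q2 \<and> q2 \<in> {0<..<q0}))" if "E = E_infty p"
  proof -
    have x: "x = 1" using that Epos by (simp add: x_def)
    have r1: "rp = 1" "rm = 1" using x by (simp_all add: rm_def rp_def r_minus_def r_plus_def)
    \<comment> \<open>The two roots coincide at 1, so the numerator is minus a square and
      \<open>f\<close> can only decrease.\<close>
    have D1: "D q = - (u q - 1)\<^sup>2 / (2 * (1 - q))" for q
      using D_eq[of q] x r1 by (simp add: power2_eq_square algebra_simps)
    have crit': "q \<in> critical_points f \<longleftrightarrow> q \<in> {0..<1} \<and> u q = 1" for q
      by (auto simp: crit D1)
    have a: "critical_points f = {}" if "b < 1"
      using crit' u_le that by fastforce
    have b: "critical_points f = {q0}" if "b = 1"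
      using crit' u_eq_b that q0 by auto
    \<comment> \<open>Only the location of the critical points is settled here. Their finiteness
      yields strict antitonicity of \<open>f\<close>, from which the saddle property follows
      afterwards.\<close>
    have c: "\<exists>l r. 0 < l \<and> l < q0 \<and> q0 < r \<and> r < 1 \<and> critical_points f = {r, l}" if "b > 1"
    proof -
      obtain l r where lr: "0 < l" "l < q0" "q0 < r" "r < 1"
        and eq: "\<And>q. q \<in> {0..1} \<Longrightarrow> u q = 1 \<longleftrightarrow> q = l \<or> q = r"
        using level[OF zero_less_one \<open>b > 1\<close>] by blast
      have "{r, l} \<subseteq> {0..<1}" "{0..<1} \<subseteq> {0..1::real}" using lr by auto
      then have "critical_points f = {r, l}"
        unfolding set_eq_iff crit' using eq by blast
      then show ?thesis using lr by blast
    qed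
    have "finite (critical_points f)"
      using a b c by (cases b "1::real" rule: linorder_cases) auto
    then have mono: "strict_antimono_on {0..<1} f"
      by (intro anti) (auto simp: D1)
    have c': "\<exists>q1 q2. critical_points f = {q1, q2} \<and> card {q1, q2} = 2 \<and>
              saddle_point f q1 \<and> q1 \<in> {q0<..<1} \<and>
              saddle_point f q2 \<and> q2 \<in> {0<..<q0}" if b1: "b > 1"
    proof -
      obtain l r where lr: "0 < l" "l < q0" "q0 < r" "r < 1" "critical_points f = {r, l}"
        using c[OF b1] by blast
      then have "saddle_point f l" "saddle_point f r"
        using anti_saddle[OF mono] by simp_all
      then show ?thesis using lr by (intro exI[of _ r] exI[of _ l]) simp
    qed
    show ?thesis using r1 mono a b c' anti_saddle[OF mono, of q0] q0 by simp
  qed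
  show ?thesis
    using case1 case2 case3 unfolding rm_def rp_def by blast
qed

end
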